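(* Let $\gamma:\mathbb{R}^k\to\mathbb{R}$ be continuously differentiable with $\gamma(0)=0$, and suppose there is a homogeneous polynomial $f\in\mathbb{R}[x_1,\dots,x_k]$ of degree $d\ge 2$ such that, as $x\to 0$, $$\gamma(x)=f(x)+o(\|x\|^{d})\quad\text{and}\quad \nabla\gamma(x)=\nabla f(x)+o(\|x\|^{d-1}).$$ Let $\hat\theta=\hat\theta_n$ be a sequence of random vectors in $\mathbb{R}^k$, let $\theta\mapsto\Sigma(\theta)$ be a continuous map from $\mathbb{R}^k$ to the positive semidefinite $k\times k$ matrices, and put $\Sigma=\Sigma(0)$. If $\sqrt{n}\,\hat\theta_n$ converges in distribution to $\mathcal{N}_k(0,\Sigma)$ as $n\to\infty$, then the Wald statistic $T_\gamma$ converges in distribution to $W_{f,\Sigma}$.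
   Context: The Wald statistic for testing $\gamma(\theta)=0$, based on the estimator $\hat\theta=\hat\theta_n$ from a sample of size $n$, is $$T_\gamma=\frac{n\,\gamma(\hat\theta)^2}{(\nabla\gamma(\hat\theta))^T\,\Sigma(\hat\theta)\,\nabla\gamma(\hat\theta)}.$$ The true parameter is $\theta=0$. For a homogeneous polynomial $f\in\mathbb{R}[x_1,\dots,x_k]$ with gradient $\nabla f$ and a positive semidefinite $k\times k$ matrix $\Sigma$ with positive diagonal entries (this is assumed of $\Sigma=\Sigma(0)$), define $$W_{f,\Sigma}=\frac{f(X)^2}{(\nabla f(X))^T\,\Sigma\,\nabla f(X)},\qquad X\sim\mathcal{N}_k(0,\Sigma).$$ It is assumed that this ratio is well-defined, i.e. its denominator is almost surely nonzero. On the event (of vanishing probability) that the denominator of $T_\gamma$ is zero, $T_\gamma$ may be given an arbitrary value. *)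

theory Defs
  imports "HOL-Probability.Probability" "HOL-Library.Landau_Symbols" "HOL-Library.Poly_Mapping"
begin

(* Real polynomials in variables indexed by the finite type 'n: a monomial is its exponent
   function, and a polynomial maps monomials to coefficients. *)
type_synonym 'n real_mpoly = "('n \<Rightarrow>\<^sub>0 nat) \<Rightarrow>\<^sub>0 real"

definition mpoly_eval :: "'n::finite real_mpoly \<Rightarrow> real ^ 'n \<Rightarrow> real" where
  "mpoly_eval p x = (\<Sum>m\<in>Poly_Mapping.keys p.
     Poly_Mapping.lookup p m * (\<Prod>i\<in>UNIV. (x $ i) ^ Poly_Mapping.lookup m i))"

(* As usual, the zero polynomial is homogeneous of every degree. *)
definition mpoly_homogeneous :: "nat \<Rightarrow> 'n::finite real_mpoly \<Rightarrow> bool" where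
  "mpoly_homogeneous d p \<longleftrightarrow>
     (\<forall>m\<in>Poly_Mapping.keys p. (\<Sum>i\<in>UNIV. Poly_Mapping.lookup m i) = d)"

(* Meaningful only where g is differentiable; see gradient_eqI. *)
definition gradient :: "('a::real_inner \<Rightarrow> real) \<Rightarrow> 'a \<Rightarrow> 'a" where
  "gradient g x = (THE D. GDERIV g x :> D)"

lemma gradient_eqI:
  assumes "GDERIV g x :> D"
  shows "gradient g x = D"
  unfolding gradient_def
proof (rule the_equality)
  fix E assume "GDERIV g x :> E"
  then have "(\<lambda>h. inner h E) = (\<lambda>h. inner h D)"
    using assms unfolding gderiv_def by (rule has_derivative_unique)
  then have "inner (E - D) E = inner (E - D) D"
    by meson
  then have "inner (E - D) (E - D) = 0"
    by (simp add: inner_diff_right)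
  then show "E = D" by simp
qed (rule assms)

lemma GDERIV_gradient:
  fixes g :: "'a::euclidean_space \<Rightarrow> real"
  assumes "g differentiable (at x)"
  shows "GDERIV g x :> gradient g x"
proof -
  obtain g' where g': "(g has_derivative g') (at x)"
    using assms by (auto simp: differentiable_def)
  have "g' = (\<lambda>h. inner h (adjoint g' 1))"
    using adjoint_works[OF has_derivative_linear[OF g'], of _ 1] by (auto simp: inner_commute)
  then have "GDERIV g x :> adjoint g' 1"
    using g' unfolding gderiv_def by simp
  then show ?thesis using gradient_eqI by metis
qed

definition quad_form :: "real ^ 'n ^ 'n \<Rightarrow> real ^ 'n \<Rightarrow> real" where
  "quad_form A v = v \<bullet> (A *v v)"

definition pos_semidefinite :: "real ^ 'n ^ 'n \<Rightarrow> bool" where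
  "pos_semidefinite A \<longleftrightarrow> transpose A = A \<and> (\<forall>v. 0 \<le> quad_form A v)"

(* The parameter v is the variance, whereas normal_density expects the standard deviation;
   variance 0 gives the point mass. *)
definition normal_law :: "real \<Rightarrow> real \<Rightarrow> real measure" where
  "normal_law \<mu> v =
     (if v = 0 then return borel \<mu> else density lborel (normal_density \<mu> (sqrt v)))"

(* X is a random vector on P with law N(\<mu>, A): every linear functional of X is normal with the
   corresponding mean and variance.  This covers singular A, for which no density exists. *)
definition multivariate_normal ::
    "'a measure \<Rightarrow> ('a \<Rightarrow> real ^ 'n) \<Rightarrow> real ^ 'n \<Rightarrow> real ^ 'n ^ 'n \<Rightarrow> bool" where
  "multivariate_normal P X \<mu> A \<longleftrightarrow> prob_space P \<and> X \<in> borel_measurable P \<and>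
     (\<forall>t. distr P borel (\<lambda>\<omega>. t \<bullet> X \<omega>) = normal_law (t \<bullet> \<mu>) (quad_form A t))"

(* Convergence in distribution on a general space; the library's weak_conv_m, through
   distribution functions, is only for measures on the real line. *)
definition weak_conv_bdd_cont ::
    "(nat \<Rightarrow> 'a::topological_space measure) \<Rightarrow> 'a measure \<Rightarrow> bool" where
  "weak_conv_bdd_cont N_seq N \<longleftrightarrow>
     (\<forall>g :: 'a \<Rightarrow> real. continuous_on UNIV g \<longrightarrow> bounded (range g) \<longrightarrow>
        (\<lambda>n. \<integral>x. g x \<partial>N_seq n) \<longlonglongrightarrow> (\<integral>x. g x \<partial>N))"

(* Wald statistic for the hypothesis \<gamma> = 0, as a function of the sample size n and of the
   value x of the estimator. *)
definition wald_statistic ::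
    "(real ^ 'n \<Rightarrow> real) \<Rightarrow> (real ^ 'n \<Rightarrow> real ^ 'n ^ 'n) \<Rightarrow> nat \<Rightarrow> real ^ 'n \<Rightarrow> real" where
  "wald_statistic \<gamma> S n x = real n * (\<gamma> x)\<^sup>2 / quad_form (S x) (gradient \<gamma> x)"

definition wald_limit :: "(real ^ 'n \<Rightarrow> real) \<Rightarrow> real ^ 'n ^ 'n \<Rightarrow> real ^ 'n \<Rightarrow> real" where
  "wald_limit f A x = (f x)\<^sup>2 / quad_form A (gradient f x)"

end

theory Submission
  imports Defs
begin

text \<open>
  Put \<open>Z\<^sub>n = \<surd>n \<theta>\<^sub>n\<close>.  Since \<open>f\<close> is homogeneous of degree \<open>d\<close> and its gradient of degree \<open>d - 1\<close>,
  multiplying numerator and denominator of the Wald statistic by \<open>n\<^bsup>d - 1\<^esup>\<close> turns it into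
  \<open>(n\<^bsup>d/2\<^esup> \<gamma>(x))\<^sup>2 / (v\<^sup>T \<Sigma>(x) v)\<close>, where \<open>x = Z\<^sub>n/\<surd>n\<close> and \<open>v = n\<^bsup>(d-1)/2\<^esup> \<nabla>\<gamma>(x)\<close>,
  with \<open>\<Sigma>\<close> written for the matrix function \<open>S\<close>.
  The two expansions at \<open>0\<close> say that, as \<open>n \<longlonglongrightarrow> \<infinity>\<close> and \<open>z' \<longlonglongrightarrow> z\<close> simultaneously, where \<open>z \<noteq> 0\<close>,
  \<open>n\<^bsup>d/2\<^esup> \<gamma>(z'/\<surd>n)\<close> tends to \<open>f(z)\<close> and \<open>n\<^bsup>(d-1)/2\<^esup> \<nabla>\<gamma>(z'/\<surd>n)\<close> tends to \<open>\<nabla>f(z)\<close>.  So the statistic,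
  as a function of \<open>n\<close> and of the value \<open>z'\<close> of \<open>Z\<^sub>n\<close>, converges to the limit ratio at \<open>z\<close> on the open
  set \<open>G\<close> of those \<open>z\<close> whose limiting denominator is nonzero
  (\<open>wald_statistic_local_limit\<close>); \<open>0\<close> is not in \<open>G\<close>, because \<open>\<nabla>f(0) = 0\<close> when \<open>d \<ge> 2\<close>.  By assumption the limit \<open>X\<close> of \<open>Z\<^sub>n\<close> is almost surely in \<open>G\<close>, and
  the extended continuous mapping theorem (\<open>extended_continuous_mapping\<close>) gives the claim.

  The extended continuous mapping theorem is proved without almost sure representations.  Up to
  a small probability, \<open>X\<close> stays in a compact subset of \<open>G\<close>, so a continuous cutoff \<open>\<phi>\<close> with
  compact support in \<open>G\<close> has \<open>E \<phi>(X)\<close>, and hence eventually \<open>E \<phi>(Z\<^sub>n)\<close>, close to \<open>1\<close>.  On the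
  support of \<open>\<phi>\<close> the convergence of the statistics \<open>T\<^sub>n\<close> to the limit function \<open>h\<close> at \<open>Z\<^sub>n\<close> is
  uniform by compactness, so for continuous
  \<open>g\<close> with values in \<open>[0,1]\<close> the expectation of \<open>g(T\<^sub>n)\<close> is close to that of \<open>\<phi>(Z\<^sub>n) g(h(Z\<^sub>n))\<close>.
  The function \<open>\<phi> \<cdot> (g \<circ> h)\<close> is bounded and continuous on the whole space, and weak convergence
  of \<open>Z\<^sub>n\<close> applies to it.
\<close>

section \<open>An extended continuous mapping theorem\<close>

text \<open>
  A property that holds locally uniformly, near each point of a compact set, holds uniformly
  on the compact set.
\<close>
lemma eventually_compact_uniform:
  assumes "compact C"
    and ev: "\<And>z. z \<in> C \<Longrightarrow> eventually P (F \<times>\<^sub>F nhds z)"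
  shows "eventually (\<lambda>n. \<forall>z\<in>C. P (n, z)) F"
proof -
  have "\<exists>Q U. eventually Q F \<and> open U \<and> z \<in> U \<and> (\<forall>n. \<forall>z'\<in>U. Q n \<longrightarrow> P (n, z'))"
    if z: "z \<in> C" for z
  proof -
    obtain Q R where "eventually Q F" "eventually R (nhds z)"
      and QR: "\<And>n z'. Q n \<Longrightarrow> R z' \<Longrightarrow> P (n, z')"
      using ev[OF z] unfolding eventually_prod_filter by blast
    moreover from \<open>eventually R (nhds z)\<close> obtain U where "open U" "z \<in> U" "\<forall>z'\<in>U. R z'"
      unfolding eventually_nhds by blast
    ultimately show ?thesis by blast
  qed
  then obtain Q U where Q: "\<And>z. z \<in> C \<Longrightarrow> eventually (Q z) F"
    and U: "\<And>z. z \<in> C \<Longrightarrow> open (U z)" "\<And>z. z \<in> C \<Longrightarrow> z \<in> U z"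
    and QU: "\<And>z n z'. z \<in> C \<Longrightarrow> z' \<in> U z \<Longrightarrow> Q z n \<Longrightarrow> P (n, z')"
    by metis
  have "C \<subseteq> (\<Union>z\<in>C. U z)" using U(2) by blast
  then obtain C' where C': "C' \<subseteq> C" "finite C'" "C \<subseteq> (\<Union>z\<in>C'. U z)"
    using compactE_image[OF \<open>compact C\<close>, of C U] U(1) by blast
  then have "eventually (\<lambda>n. \<forall>z\<in>C'. Q z n) F"
    using Q by (auto intro!: eventually_ball_finite)
  then show ?thesis
    by (rule eventually_mono) (use C' QU in blast)
qed

text \<open>
  Inner regularity gives a compact \<open>K \<subseteq> G\<close> of measure close to \<open>1\<close>; the cutoff is \<open>1\<close> on \<open>K\<close> and
  decreases linearly with the distance from \<open>K\<close>.
\<close>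
lemma compact_support_cutoff:
  fixes G :: "'a::euclidean_space set" and \<mu> :: "'a measure"
  assumes \<mu>: "prob_space \<mu>" "sets \<mu> = sets borel"
    and G: "open G" "AE x in \<mu>. x \<in> G" and e: "e > 0"
  obtains \<phi> :: "'a \<Rightarrow> real" and C where "continuous_on UNIV \<phi>" "\<And>x. 0 \<le> \<phi> x" "\<And>x. \<phi> x \<le> 1"
    "compact C" "C \<subseteq> G" "\<And>x. x \<notin> C \<Longrightarrow> \<phi> x = 0" "1 - e < (\<integral>x. \<phi> x \<partial>\<mu>)"
proof -
  interpret prob_space \<mu> by fact
  \<comment> \<open>Truncating at \<open>1\<close> makes \<open>1 - e'\<close> nonnegative, so that it embeds in the extended
    nonnegative reals, and forces \<open>K\<close> below to be nonempty.\<close>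
  define e' where "e' = min e 1"
  have G_sets: "G \<in> sets \<mu>" using G(1) \<mu>(2) by simp
  have "emeasure \<mu> G = 1"
    using G(2) G_sets by (simp add: emeasure_eq_1_AE)
  then have "1 = (SUP K\<in>{K. K \<subseteq> G \<and> compact K}. emeasure \<mu> K)"
    using inner_regular[of \<mu> G] \<mu>(2) G(1) by simp
  then have "ennreal (1 - e') < (SUP K\<in>{K. K \<subseteq> G \<and> compact K}. emeasure \<mu> K)"
    using e by (auto simp: e'_def ennreal_less_one_iff)
  then obtain K where K: "K \<subseteq> G" "compact K" "ennreal (1 - e') < emeasure \<mu> K"
    by (auto simp: less_SUP_iff)
  then have mK: "1 - e' < measure \<mu> K"
    by (simp add: emeasure_eq_measure e'_def ennreal_less_iff)
  then have "K \<noteq> {}" using e by (auto simp: e'_def)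
  obtain r where r: "r > 0" "(\<Union>x\<in>K. cball x r) \<subseteq> G"
    using compact_subset_open_imp_cball_epsilon_subset[OF K(2) G(1) K(1)] .
  define C where "C = {x. infdist x K \<le> r}"
  define \<phi> where "\<phi> x = max 0 (1 - infdist x K / r)" for x
  have cont: "continuous_on UNIV \<phi>"
    unfolding \<phi>_def using r by (intro continuous_intros) auto
  have bound: "0 \<le> \<phi> x" "\<phi> x \<le> 1" for x
    using r by (auto simp: \<phi>_def infdist_nonneg)
  have "compact C"
    unfolding C_def using \<open>K \<noteq> {}\<close> K(2) r(1) by (rule compact_infdist_le)
  moreover have "C \<subseteq> G"
  proof
    fix x assume "x \<in> C"
    obtain y where "y \<in> K" "infdist x K = dist x y"
      using infdist_attains_inf[OF compact_imp_closed[OF K(2)] \<open>K \<noteq> {}\<close>] by blast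
    then show "x \<in> G" using r(2) \<open>x \<in> C\<close> by (force simp: C_def dist_commute)
  qed
  moreover have "\<phi> x = 0" if "x \<notin> C" for x
    using that r(1) by (auto simp: \<phi>_def C_def field_simps)
  moreover have "1 - e < (\<integral>x. \<phi> x \<partial>\<mu>)"
  proof -
    have [measurable]: "\<phi> \<in> borel_measurable \<mu>"
      using borel_measurable_continuous_onI[OF cont] measurable_cong_sets[OF \<mu>(2) refl] by blast
    have [measurable]: "K \<in> sets \<mu>" using K(2) \<mu>(2) by (simp add: borel_compact)
    have "1 - e < measure \<mu> K" using mK by (simp add: e'_def)
    also have "\<dots> = (\<integral>x. indicator K x \<partial>\<mu>)"
      using \<open>K \<in> sets \<mu>\<close> by (simp add: sets.Int_space_eq2)
    also have "\<dots> \<le> (\<integral>x. \<phi> x \<partial>\<mu>)"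
    proof (rule integral_mono)
      show "integrable \<mu> \<phi>"
        using bound by (intro integrable_const_bound[where B = 1]) auto
      show "indicator K x \<le> \<phi> x" for x
        using bound by (auto simp: indicator_def \<phi>_def)
    qed (simp add: less_top[symmetric])
    finally show ?thesis .
  qed
  ultimately show ?thesis using that cont bound by blast
qed

lemma (in prob_space) expectation_cutoff:
  fixes a b :: "'a \<Rightarrow> real"
  assumes [measurable]: "a \<in> borel_measurable M" "b \<in> borel_measurable M"
    and "\<And>x. 0 \<le> a x" "\<And>x. a x \<le> 1" "\<And>x. 0 \<le> b x" "\<And>x. b x \<le> 1"
  shows "\<bar>expectation b - expectation (\<lambda>x. a x * b x)\<bar> \<le> 1 - expectation a"
proof -
  have int: "integrable M a" "integrable M b" "integrable M (\<lambda>x. a x * b x)"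
    using assms by (auto intro!: integrable_const_bound[where B = 1] AE_I2 mult_le_one)
  have "\<bar>expectation (\<lambda>x. b x - a x * b x)\<bar> \<le> expectation (\<lambda>x. \<bar>b x - a x * b x\<bar>)"
    by (rule integral_abs_bound)
  also have "\<dots> \<le> expectation (\<lambda>x. 1 - a x)"
  proof (rule integral_mono)
    fix x
    have "(1 - a x) * b x \<le> 1 - a x" "0 \<le> (1 - a x) * b x"
      using assms(3-6)[of x] by (auto intro: mult_left_le)
    then show "\<bar>b x - a x * b x\<bar> \<le> 1 - a x" by (simp add: algebra_simps)
  qed (use int in auto)
  also have "\<dots> = 1 - expectation a"
    using int by (simp add: prob_space)
  finally show ?thesis using int by simp
qed

text \<open>
  If \<open>Z\<^sub>n\<close> converges in distribution to \<open>X\<close> and \<open>T\<^sub>n\<close> converges to \<open>h(z)\<close> whenever \<open>n \<longlonglongrightarrow> \<infinity>\<close> and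
  \<open>Z\<^sub>n \<longlonglongrightarrow> z\<close>, for each \<open>z\<close> in an open set \<open>G\<close> that contains \<open>X\<close> almost surely and on
  which \<open>h\<close> is continuous, then \<open>T\<^sub>n\<close> converges in
  distribution to \<open>h(X)\<close>.  The last hypothesis states the convergence of \<open>T\<^sub>n\<close> pointwise on the
  sample space, so that \<open>T\<^sub>n\<close> need not be a function of \<open>Z\<^sub>n\<close>.
\<close>
theorem extended_continuous_mapping:
  fixes G :: "'c::euclidean_space set" and h :: "'c \<Rightarrow> real"
    and M :: "nat \<Rightarrow> 'a measure" and Z :: "nat \<Rightarrow> 'a \<Rightarrow> 'c" and T :: "nat \<Rightarrow> 'a \<Rightarrow> real"
    and P :: "'b measure" and X :: "'b \<Rightarrow> 'c"
  assumes M: "\<And>n. prob_space (M n)" and P: "prob_space P"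
    and [measurable]: "\<And>n. Z n \<in> borel_measurable (M n)" "\<And>n. T n \<in> borel_measurable (M n)"
      "X \<in> borel_measurable P" "h \<in> borel_measurable borel"
    and Z_conv: "weak_conv_bdd_cont (\<lambda>n. distr (M n) borel (Z n)) (distr P borel X)"
    and G: "open G" "AE \<omega> in P. X \<omega> \<in> G" and h_cont: "continuous_on G h"
    and T_conv: "\<And>z e. z \<in> G \<Longrightarrow> e > 0 \<Longrightarrow>
      \<forall>\<^sub>F (n, z') in sequentially \<times>\<^sub>F nhds z. \<forall>\<omega>\<in>space (M n). Z n \<omega> = z' \<longrightarrow> \<bar>T n \<omega> - h z\<bar> < e"
  shows "weak_conv_m (\<lambda>n. distr (M n) borel (T n)) (distr P borel (\<lambda>\<omega>. h (X \<omega>)))"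
proof (rule integral_cts_step_conv_imp_weak_conv)
  show "real_distribution (distr (M n) borel (T n))" for n
    by (rule prob_space.real_distribution_distr[OF M]) simp
  show "real_distribution (distr P borel (\<lambda>\<omega>. h (X \<omega>)))"
    by (rule prob_space.real_distribution_distr[OF P]) simp
  fix a b :: real assume "a < b"
  define g where "g = cts_step a b"
  have g_cont: "continuous_on UNIV g"
    unfolding g_def using \<open>a < b\<close>
    by (intro uniformly_continuous_imp_continuous cts_step_uniformly_continuous)
  then have [measurable]: "g \<in> borel_measurable borel"
    by (rule borel_measurable_continuous_onI)
  have g_bound: "0 \<le> g x" "g x \<le> 1" for x
    using \<open>a < b\<close> by (auto simp: g_def cts_step_def)
  have "(\<lambda>n. \<integral>\<omega>. g (T n \<omega>) \<partial>M n) \<longlonglongrightarrow> (\<integral>\<omega>. g (h (X \<omega>)) \<partial>P)"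
  proof (rule LIMSEQ_I)
    fix e :: real assume "e > 0"
    interpret P: prob_space P by fact
    have "prob_space (distr P borel X)" by (rule P.prob_space_distr) simp
    moreover have "AE x in distr P borel X. x \<in> G"
      using G by (subst AE_distr_iff) auto
    ultimately obtain \<phi> :: "'c \<Rightarrow> real" and C where \<phi>_cont: "continuous_on UNIV \<phi>" 
      and \<phi>_bound: "\<And>x. 0 \<le> \<phi> x" "\<And>x. \<phi> x \<le> 1"
      and C: "compact C" "C \<subseteq> G" "\<And>x. x \<notin> C \<Longrightarrow> \<phi> x = 0"
      and "1 - e / 4 < (\<integral>x. \<phi> x \<partial>distr P borel X)"
      using compact_support_cutoff[of "distr P borel X" G "e / 4"] G(1) \<open>e > 0\<close> by auto
    have [measurable]: "\<phi> \<in> borel_measurable borel"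
      using \<phi>_cont by (rule borel_measurable_continuous_onI)
    have \<phi>_int: "1 - e / 4 < (\<integral>\<omega>. \<phi> (X \<omega>) \<partial>P)"
      using \<open>1 - e / 4 < _\<close> by (simp add: integral_distr)
    \<comment> \<open>Outside \<open>G\<close> the function \<open>h\<close> may be discontinuous, but there \<open>\<phi>\<close> vanishes.\<close>
    define u where "u x = \<phi> x * g (h x)" for x
    have u_bound: "0 \<le> u x" "u x \<le> 1" for x
      using \<phi>_bound g_bound by (auto simp: u_def intro: mult_le_one)
    have "continuous_on (G \<union> - C) u"
    proof (rule continuous_on_open_Un)
      show "continuous_on G u" unfolding u_def
        by (intro continuous_on_mult continuous_on_subset[OF \<phi>_cont]
            continuous_on_compose2[OF g_cont h_cont]) auto
      show "continuous_on (- C) u"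
        by (rule continuous_on_cong[THEN iffD2, OF refl, of _ _ "\<lambda>_. 0"])
          (auto simp: u_def C(3))
      show "open (- C)" using C(1) by (simp add: compact_imp_closed open_Compl)
    qed (rule G)
    then have u_cont: "continuous_on UNIV u"
      by (rule continuous_on_subset) (use C(2) in auto)
    then have [measurable]: "u \<in> borel_measurable borel"
      by (rule borel_measurable_continuous_onI)
    have lim: "(\<lambda>n. \<integral>\<omega>. k (Z n \<omega>) \<partial>M n) \<longlonglongrightarrow> (\<integral>\<omega>. k (X \<omega>) \<partial>P)"
      if "continuous_on UNIV k" "\<And>x. 0 \<le> k x" "\<And>x. k x \<le> 1" for k :: "'c \<Rightarrow> real"
    proof -
      have [measurable]: "k \<in> borel_measurable borel"
        using that(1) by (rule borel_measurable_continuous_onI)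
      have "bounded (range k)"
        using that by (intro boundedI[of _ 1]) auto
      then have "(\<lambda>n. \<integral>x. k x \<partial>distr (M n) borel (Z n)) \<longlonglongrightarrow> (\<integral>x. k x \<partial>distr P borel X)"
        using Z_conv that(1) unfolding weak_conv_bdd_cont_def by blast
      then show ?thesis by (simp add: integral_distr)
    qed
    have ev1: "\<forall>\<^sub>F n in sequentially. 1 - e / 4 < (\<integral>\<omega>. \<phi> (Z n \<omega>) \<partial>M n)"
      using lim[OF \<phi>_cont \<phi>_bound] \<phi>_int by (rule order_tendstoD)
    have ev2: "\<forall>\<^sub>F n in sequentially. \<bar>(\<integral>\<omega>. u (Z n \<omega>) \<partial>M n) - (\<integral>\<omega>. u (X \<omega>) \<partial>P)\<bar> < e / 4"
      using tendstoD[OF lim[OF u_cont u_bound], of "e / 4"] \<open>e > 0\<close> by (simp add: dist_real_def)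
    have ev3: "\<forall>\<^sub>F n in sequentially. \<forall>z\<in>C. case (n, z) of (n, z) \<Rightarrow>
        \<forall>\<omega>\<in>space (M n). Z n \<omega> = z \<longrightarrow> \<bar>g (T n \<omega>) - g (h z)\<bar> < e / 4"
    proof (rule eventually_compact_uniform[OF C(1)])
      fix z assume "z \<in> C"
      then have "z \<in> G" using C(2) by blast
      have "isCont g (h z)" using g_cont by (simp add: continuous_on_eq_continuous_at)
      then obtain r where r: "r > 0" "\<And>y. \<bar>y - h z\<bar> < r \<Longrightarrow> \<bar>g y - g (h z)\<bar> < e / 8"
        using \<open>e > 0\<close> unfolding continuous_at_eps_delta dist_real_def
        by (metis half_gt_zero_iff divide_pos_pos zero_less_numeral)
      have "isCont h z" using h_cont G(1) \<open>z \<in> G\<close> by (simp add: continuous_on_eq_continuous_at)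
      then have "(h \<longlongrightarrow> h z) (nhds z)"
        by (simp add: isCont_def tendsto_nhds_iff)
      then have "\<forall>\<^sub>F z' in nhds z. \<bar>h z' - h z\<bar> < r"
        using tendstoD r(1) by (fastforce simp: dist_real_def)
      then have "\<forall>\<^sub>F p in sequentially \<times>\<^sub>F nhds z. \<bar>h (snd p) - h z\<bar> < r"
        using filterlim_snd unfolding filterlim_iff by blast
      with T_conv[OF \<open>z \<in> G\<close> r(1)]
      show "\<forall>\<^sub>F (n, z') in sequentially \<times>\<^sub>F nhds z.
          \<forall>\<omega>\<in>space (M n). Z n \<omega> = z' \<longrightarrow> \<bar>g (T n \<omega>) - g (h z')\<bar> < e / 4"
      proof eventually_elim
        case (elim p)
        show ?case
        proof (clarsimp split: prod.splits)
          fix n \<omega> assume "p = (n, Z n \<omega>)" "\<omega> \<in> space (M n)"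
          with elim have "\<bar>g (T n \<omega>) - g (h z)\<bar> < e / 8" "\<bar>g (h (Z n \<omega>)) - g (h z)\<bar> < e / 8"
            using r(2) by auto
          then have "\<bar>g (T n \<omega>) - g (h (Z n \<omega>))\<bar> < e / 8 + e / 8" by arith
          then show "\<bar>g (T n \<omega>) - g (h (Z n \<omega>))\<bar> * 4 < e" by simp
        qed
      qed
    qed
    show "\<exists>no. \<forall>n\<ge>no. norm ((\<integral>\<omega>. g (T n \<omega>) \<partial>M n) - (\<integral>\<omega>. g (h (X \<omega>)) \<partial>P)) < e"
      unfolding eventually_sequentially[symmetric]
      using ev1 ev2 ev3
    proof eventually_elim
      case (elim n)
      interpret Mn: prob_space "M n" by (rule M)
      have "\<bar>(\<integral>\<omega>. g (T n \<omega>) \<partial>M n) - (\<integral>\<omega>. \<phi> (Z n \<omega>) * g (T n \<omega>) \<partial>M n)\<bar>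
          \<le> 1 - (\<integral>\<omega>. \<phi> (Z n \<omega>) \<partial>M n)"
        using \<phi>_bound g_bound by (intro Mn.expectation_cutoff) auto
      moreover have "\<bar>(\<integral>\<omega>. g (h (X \<omega>)) \<partial>P) - (\<integral>\<omega>. u (X \<omega>) \<partial>P)\<bar> \<le> 1 - (\<integral>\<omega>. \<phi> (X \<omega>) \<partial>P)"
        unfolding u_def using \<phi>_bound g_bound by (intro P.expectation_cutoff) auto
      moreover have "\<bar>(\<integral>\<omega>. \<phi> (Z n \<omega>) * g (T n \<omega>) \<partial>M n) - (\<integral>\<omega>. u (Z n \<omega>) \<partial>M n)\<bar> \<le> e / 4"
      proof -
        have int: "integrable (M n) (\<lambda>\<omega>. \<phi> (Z n \<omega>) * g (T n \<omega>))"
          "integrable (M n) (\<lambda>\<omega>. u (Z n \<omega>))"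
          using \<phi>_bound g_bound u_bound
          by (auto intro!: Mn.integrable_const_bound[where B = 1] AE_I2 mult_le_one)
        have "\<bar>(\<integral>\<omega>. \<phi> (Z n \<omega>) * g (T n \<omega>) - u (Z n \<omega>) \<partial>M n)\<bar>
            \<le> (\<integral>\<omega>. \<bar>\<phi> (Z n \<omega>) * g (T n \<omega>) - u (Z n \<omega>)\<bar> \<partial>M n)"
          by (rule integral_abs_bound)
        also have "\<dots> \<le> (\<integral>\<omega>. e / 4 \<partial>M n)"
        proof (rule integral_mono)
          fix \<omega> assume \<omega>: "\<omega> \<in> space (M n)"
          show "\<bar>\<phi> (Z n \<omega>) * g (T n \<omega>) - u (Z n \<omega>)\<bar> \<le> e / 4"
          proof (cases "Z n \<omega> \<in> C")
            case True
            then have "\<bar>g (T n \<omega>) - g (h (Z n \<omega>))\<bar> \<le> e / 4" using elim \<omega> by force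
            then have "\<phi> (Z n \<omega>) * \<bar>g (T n \<omega>) - g (h (Z n \<omega>))\<bar> \<le> 1 * (e / 4)"
              using \<phi>_bound by (intro mult_mono) auto
            then show ?thesis
              using \<phi>_bound(1)[of "Z n \<omega>"]
              by (simp add: u_def abs_mult right_diff_distrib[symmetric])
          qed (use C(3) \<open>e > 0\<close> in \<open>simp add: u_def\<close>)
        qed (use int in auto)
        finally show ?thesis using int by (simp add: Mn.prob_space)
      qed
      ultimately show ?case
        using elim(1,2) \<phi>_int unfolding real_norm_def by linarith
    qed
  qed
  then show "(\<lambda>n. integral\<^sup>L (distr (M n) borel (T n)) (cts_step a b))
      \<longlonglongrightarrow> integral\<^sup>L (distr P borel (\<lambda>\<omega>. h (X \<omega>))) (cts_step a b)"
    by (simp add: integral_distr g_def[symmetric])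
qed

section \<open>Continuously differentiable functions and homogeneous polynomials\<close>

text \<open>
  A real function on an inner product space that has a continuous gradient everywhere.
\<close>
definition C1_fun :: "('a::real_inner \<Rightarrow> real) \<Rightarrow> bool" where
  "C1_fun g \<longleftrightarrow> (\<exists>D. (\<forall>x. GDERIV g x :> D x) \<and> continuous_on UNIV D)"

lemma C1_fun_gradient:
  assumes "C1_fun g"
  shows "GDERIV g x :> gradient g x" "continuous_on UNIV (gradient g)"
proof -
  obtain D where D: "\<And>x. GDERIV g x :> D x" "continuous_on UNIV D"
    using assms by (auto simp: C1_fun_def)
  then have "gradient g = D" by (intro ext gradient_eqI)
  with D show "GDERIV g x :> gradient g x" "continuous_on UNIV (gradient g)" by simp_all
qed

lemma C1_fun_continuous: "C1_fun g \<Longrightarrow> continuous_on UNIV g"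
  unfolding C1_fun_def gderiv_def
  by (metis continuous_at_imp_continuous_on has_derivative_continuous)

lemma C1_fun_const: "C1_fun (\<lambda>_. c)"
  unfolding C1_fun_def by (intro exI[of _ "\<lambda>_. 0"]) (simp add: GDERIV_const)

lemma C1_fun_nth: "C1_fun (\<lambda>x :: real ^ 'n::finite. x $ i)"
  unfolding C1_fun_def gderiv_def
  by (intro exI[of _ "\<lambda>_. axis i 1"])
    (auto simp: inner_axis intro!: bounded_linear_imp_has_derivative bounded_linear_vec_nth)

lemma C1_fun_add: "C1_fun f \<Longrightarrow> C1_fun g \<Longrightarrow> C1_fun (\<lambda>x. f x + g x)"
  unfolding C1_fun_def by (fast intro: GDERIV_add continuous_on_add)

lemma C1_fun_mult:
  assumes "C1_fun f" "C1_fun g"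
  shows "C1_fun (\<lambda>x. f x * g x)"
  unfolding C1_fun_def
proof (intro exI conjI allI)
  show "GDERIV (\<lambda>x. f x * g x) x :> f x *\<^sub>R gradient g x + g x *\<^sub>R gradient f x" for x
    using assms by (intro GDERIV_mult C1_fun_gradient)
  show "continuous_on UNIV (\<lambda>x. f x *\<^sub>R gradient g x + g x *\<^sub>R gradient f x)"
    using assms by (intro continuous_intros C1_fun_gradient C1_fun_continuous)
qed

lemma C1_fun_sum: "(\<And>i. i \<in> A \<Longrightarrow> C1_fun (f i)) \<Longrightarrow> C1_fun (\<lambda>x. \<Sum>i\<in>A. f i x)"
  by (induction A rule: infinite_finite_induct) (auto intro: C1_fun_const C1_fun_add)

lemma C1_fun_prod: "(\<And>i. i \<in> A \<Longrightarrow> C1_fun (f i)) \<Longrightarrow> C1_fun (\<lambda>x. \<Prod>i\<in>A. f i x)"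
  by (induction A rule: infinite_finite_induct) (auto intro: C1_fun_const C1_fun_mult)

lemma C1_fun_power: "C1_fun f \<Longrightarrow> C1_fun (\<lambda>x. f x ^ k)"
  by (induction k) (auto intro: C1_fun_const C1_fun_mult)

lemma C1_fun_mpoly_eval: "C1_fun (mpoly_eval p)"
  unfolding mpoly_eval_def[abs_def]
  by (intro C1_fun_sum C1_fun_mult C1_fun_const C1_fun_prod C1_fun_power C1_fun_nth)

lemma mpoly_eval_scaleR:
  assumes "mpoly_homogeneous d p"
  shows "mpoly_eval p (c *\<^sub>R x) = c ^ d * mpoly_eval p x"
proof -
  have "(\<Prod>i\<in>UNIV. ((c *\<^sub>R x) $ i) ^ Poly_Mapping.lookup m i)
      = c ^ d * (\<Prod>i\<in>UNIV. (x $ i) ^ Poly_Mapping.lookup m i)" if "m \<in> Poly_Mapping.keys p" for m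
  proof -
    have "c ^ d = (\<Prod>i\<in>UNIV. c ^ Poly_Mapping.lookup m i)"
      using assms that by (auto simp: mpoly_homogeneous_def power_sum)
    then show ?thesis by (simp add: power_mult_distrib prod.distrib)
  qed
  then show ?thesis
    by (simp add: mpoly_eval_def sum_distrib_left mult.left_commute)
qed

text \<open>
  Differentiating \<open>f (c x) = c\<^sup>d f x\<close> with respect to \<open>x\<close> gives the claim for \<open>c \<noteq> 0\<close>.  The case
  \<open>c = 0\<close>, which says that \<open>\<nabla>f(0) = 0\<close> when \<open>d \<ge> 2\<close>, follows by continuity of the gradient.
\<close>
lemma gradient_scaleR:
  fixes f :: "'a::euclidean_space \<Rightarrow> real"
  assumes f: "C1_fun f" and hom: "\<And>c x. f (c *\<^sub>R x) = c ^ d * f x" and "d > 0"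
  shows "gradient f (c *\<^sub>R x) = c ^ (d - 1) *\<^sub>R gradient f x"
proof -
  have *: "gradient f (c *\<^sub>R x) = c ^ (d - 1) *\<^sub>R gradient f x" if "c \<noteq> 0" for c
  proof -
    have "((\<lambda>y. f (c *\<^sub>R y)) has_derivative (\<lambda>h. inner (c *\<^sub>R h) (gradient f (c *\<^sub>R x)))) (at x)"
      by (rule has_derivative_compose[OF has_derivative_scaleR_right[OF has_derivative_ident],
          OF C1_fun_gradient(1)[OF f, unfolded gderiv_def]])
    then have 1: "GDERIV (\<lambda>y. f (c *\<^sub>R y)) x :> c *\<^sub>R gradient f (c *\<^sub>R x)"
      by (simp add: gderiv_def)
    have "GDERIV (\<lambda>y. c ^ d * f y) x :> c ^ d *\<^sub>R gradient f x + f x *\<^sub>R 0"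
      by (intro GDERIV_mult GDERIV_const C1_fun_gradient(1) f)
    then have "GDERIV (\<lambda>y. f (c *\<^sub>R y)) x :> c ^ d *\<^sub>R gradient f x"
      by (simp add: hom)
    with 1 have "c *\<^sub>R gradient f (c *\<^sub>R x) = c ^ d *\<^sub>R gradient f x"
      using gradient_eqI by metis
    also have "\<dots> = c *\<^sub>R (c ^ (d - 1) *\<^sub>R gradient f x)"
      using \<open>d > 0\<close> by (simp add: power_eq_if)
    finally show ?thesis using that by (metis scaleR_cancel_left)
  qed
  have "((\<lambda>c. gradient f (c *\<^sub>R x)) \<longlongrightarrow> gradient f (0 *\<^sub>R x)) (at 0)"
    using C1_fun_gradient(2)[OF f] 
    by (intro isCont_tendsto_compose[of _ "gradient f"] tendsto_intros)
      (auto simp: continuous_on_eq_continuous_at)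
  moreover have "((\<lambda>c. gradient f (c *\<^sub>R x)) \<longlongrightarrow> 0 ^ (d - 1) *\<^sub>R gradient f x) (at 0)"
    by (rule Lim_transform_eventually[of "\<lambda>c. c ^ (d - 1) *\<^sub>R gradient f x"])
      (auto simp: * eventually_at_filter intro!: tendsto_intros)
  ultimately have "gradient f (0 *\<^sub>R x) = 0 ^ (d - 1) *\<^sub>R gradient f x"
    by (rule tendsto_unique[rotated]) simp
  with * show ?thesis by (cases "c = 0") auto
qed

section \<open>The Wald statistic at a rescaled argument\<close>

lemma quad_form_scaleR: "quad_form A (c *\<^sub>R v) = c\<^sup>2 * quad_form A v"
  by (simp add: quad_form_def matrix_vector_mult_scaleR power2_eq_square)

lemma tendsto_quad_form:
  fixes A :: "'b \<Rightarrow> real ^ 'n::finite ^ 'n"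
  assumes "(A \<longlongrightarrow> A0) F" "(v \<longlongrightarrow> v0) F"
  shows "((\<lambda>x. quad_form (A x) (v x)) \<longlongrightarrow> quad_form A0 v0) F"
  unfolding quad_form_def matrix_vector_mult_def
  using assms by (intro tendsto_intros) auto

lemma eventually_fst_pos: "\<forall>\<^sub>F p in sequentially \<times>\<^sub>F F. 0 < fst p"
  using filterlim_fst eventually_gt_at_top[of 0] unfolding filterlim_iff by blast

text \<open>
  In what follows, convergence as \<open>n \<longlonglongrightarrow> \<infinity>\<close> and \<open>z' \<longlonglongrightarrow> z\<close> simultaneously is convergence of
  functions of the pair \<open>p = (n, z')\<close> along \<open>sequentially \<times>\<^sub>F nhds z\<close>.  The condition \<open>z \<noteq> 0\<close> keeps
  \<open>z'/\<surd>n\<close> away from \<open>0\<close>, where a little-o estimate at \<open>0\<close> says nothing.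
\<close>
lemma filterlim_rescaled_at_0:
  fixes z :: "'a::real_normed_vector"
  assumes "z \<noteq> 0"
  shows "filterlim (\<lambda>p. snd p /\<^sub>R sqrt (real (fst p))) (at 0) (sequentially \<times>\<^sub>F nhds z)"
proof -
  let ?F = "sequentially \<times>\<^sub>F nhds z"
  let ?x = "\<lambda>p::nat \<times> 'a. snd p /\<^sub>R sqrt (real (fst p))"
  have n: "filterlim (\<lambda>p. sqrt (real (fst p))) at_top ?F"
    by (intro filterlim_compose[OF sqrt_at_top] filterlim_compose[OF filterlim_real_sequentially]
        filterlim_fst)
  have z: "(snd \<longlongrightarrow> z) ?F" by (rule filterlim_snd)
  have ev_z: "\<forall>\<^sub>F p in ?F. snd p \<noteq> 0"
    using z assms by (rule tendsto_imp_eventually_ne)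
  have "(?x \<longlongrightarrow> 0 *\<^sub>R z) ?F"
    by (intro tendsto_scaleR tendsto_inverse_0_at_top n z)
  then show "filterlim ?x (at 0) ?F"
    unfolding filterlim_at using eventually_conj[OF eventually_fst_pos ev_z]
    by (auto elim: eventually_mono)
qed

text \<open>
  With \<open>x = z'/\<surd>n\<close> one has \<open>n\<^bsup>k/2\<^esup> r(x) = \<parallel>z'\<parallel>\<^sup>k \<cdot> r(x)/\<parallel>x\<parallel>\<^sup>k\<close>, whose first factor stays bounded.
\<close>
lemma tendsto_rescaled_smallo:
  fixes r :: "'a::real_normed_vector \<Rightarrow> real"
  assumes r: "r \<in> o[at 0](\<lambda>x. norm x ^ k)" and "z \<noteq> 0"
  shows "((\<lambda>p. sqrt (real (fst p)) ^ k * r (snd p /\<^sub>R sqrt (real (fst p)))) \<longlongrightarrow> 0)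
    (sequentially \<times>\<^sub>F nhds z)"
proof -
  let ?F = "sequentially \<times>\<^sub>F nhds z"
  let ?x = "\<lambda>p::nat \<times> 'a. snd p /\<^sub>R sqrt (real (fst p))"
  have z: "(snd \<longlongrightarrow> z) ?F" by (rule filterlim_snd)
  have "((\<lambda>x. r x / norm x ^ k) \<longlongrightarrow> 0) (at 0)"
    using r by (rule smalloD_tendsto)
  then have "((\<lambda>p. r (?x p) / norm (?x p) ^ k) \<longlongrightarrow> 0) ?F"
    using filterlim_rescaled_at_0[OF \<open>z \<noteq> 0\<close>] by (rule filterlim_compose)
  then have "((\<lambda>p. norm (snd p) ^ k * (r (?x p) / norm (?x p) ^ k)) \<longlongrightarrow> norm z ^ k * 0) ?F"
    by (intro tendsto_mult tendsto_power tendsto_norm z)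
  then have "((\<lambda>p. norm (snd p) ^ k * (r (?x p) / norm (?x p) ^ k)) \<longlongrightarrow> 0) ?F" by simp
  moreover have "\<forall>\<^sub>F p in ?F. norm (snd p) ^ k * (r (?x p) / norm (?x p) ^ k) =
      sqrt (real (fst p)) ^ k * r (?x p)"
    using eventually_fst_pos tendsto_imp_eventually_ne[OF z \<open>z \<noteq> 0\<close>]
    by eventually_elim (simp add: power_mult_distrib power_divide field_simps)
  ultimately show ?thesis
    by (rule Lim_transform_eventually)
qed

text \<open>
  Valid also where the denominator vanishes, since both sides are then \<open>0\<close>.
\<close>
lemma wald_statistic_rescaled:
  assumes "n > 0" "d > 0"
  shows "wald_statistic \<gamma> S n x =
    (sqrt (real n) ^ d * \<gamma> x)\<^sup>2 / quad_form (S x) (sqrt (real n) ^ (d - 1) *\<^sub>R gradient \<gamma> x)"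
proof -
  obtain k where k: "d = Suc k" using \<open>d > 0\<close> gr0_conv_Suc by blast
  define s where "s = sqrt (real n)"
  have s: "s > 0" "real n = s\<^sup>2" using \<open>n > 0\<close> by (auto simp: s_def)
  have "(s ^ d * \<gamma> x)\<^sup>2 / quad_form (S x) (s ^ (d - 1) *\<^sub>R gradient \<gamma> x)
      = ((s ^ k)\<^sup>2 * (s\<^sup>2 * (\<gamma> x)\<^sup>2)) / ((s ^ k)\<^sup>2 * quad_form (S x) (gradient \<gamma> x))"
    by (simp add: k quad_form_scaleR power_mult_distrib mult_ac)
  also have "\<dots> = wald_statistic \<gamma> S n x"
    using s(1) by (simp add: wald_statistic_def s(2))
  finally show ?thesis by (simp add: s_def)
qed

text \<open>
  The second conclusion makes the value of the statistic at a vanishing denominator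
  irrelevant near \<open>z\<close>.
\<close>
lemma wald_statistic_local_limit:
  fixes \<gamma> :: "real ^ 'n::finite \<Rightarrow> real" and S :: "real ^ 'n \<Rightarrow> real ^ 'n ^ 'n"
  assumes f: "C1_fun f" and hom: "\<And>c x. f (c *\<^sub>R x) = c ^ d * f x" and d: "d \<ge> 2"
    and \<gamma>_expansion: "(\<lambda>x. \<gamma> x - f x) \<in> o[at 0](\<lambda>x. norm x ^ d)"
    and gradient_expansion:
      "(\<lambda>x. norm (gradient \<gamma> x - gradient f x)) \<in> o[at 0](\<lambda>x. norm x ^ (d - 1))"
    and S_cont: "isCont S 0"
    and z: "quad_form (S 0) (gradient f z) \<noteq> 0"
  defines "x \<equiv> \<lambda>p. snd p /\<^sub>R sqrt (real (fst p))"
  shows "((\<lambda>p. wald_statistic \<gamma> S (fst p) (x p)) \<longlongrightarrow> wald_limit f (S 0) z) (sequentially \<times>\<^sub>F nhds z)"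
    and "\<forall>\<^sub>F p in sequentially \<times>\<^sub>F nhds z. quad_form (S (x p)) (gradient \<gamma> (x p)) \<noteq> 0"
proof -
  let ?F = "sequentially \<times>\<^sub>F nhds z"
  define s where "s p = sqrt (real (fst p))" for p :: "nat \<times> (real ^ 'n)"
  have grad_hom: "gradient f (c *\<^sub>R y) = c ^ (d - 1) *\<^sub>R gradient f y" for c y
    using gradient_scaleR[OF f hom] d by simp
  have "gradient f 0 = 0"
    using grad_hom[of 0 0] d by (simp add: power_0_left)
  \<comment> \<open>This is where \<open>d \<ge> 2\<close> matters: the limiting denominator vanishes at \<open>0\<close>.\<close>
  then have "z \<noteq> 0" using z by (auto simp: quad_form_def)
  have snd: "(snd \<longlongrightarrow> z) ?F" by (rule filterlim_snd)
  have pos: "\<forall>\<^sub>F p in ?F. s p > 0"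
    using eventually_fst_pos by eventually_elim (simp add: s_def)
  have z': "snd p = s p *\<^sub>R x p" if "s p > 0" for p
    using that by (simp add: x_def s_def)
  have "isCont f z" "isCont (gradient f) z"
    using C1_fun_continuous[OF f] C1_fun_gradient(2)[OF f]
    by (simp_all add: continuous_on_eq_continuous_at)
  then have f_lim: "((\<lambda>p. f (snd p)) \<longlongrightarrow> f z) ?F"
    and grad_lim: "((\<lambda>p. gradient f (snd p)) \<longlongrightarrow> gradient f z) ?F"
    using snd by (blast intro: isCont_tendsto_compose)+

  have "((\<lambda>p. f (snd p) + s p ^ d * (\<gamma> (x p) - f (x p))) \<longlongrightarrow> f z + 0) ?F"
    unfolding s_def x_def
    by (intro tendsto_add f_lim tendsto_rescaled_smallo[OF \<gamma>_expansion \<open>z \<noteq> 0\<close>])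
  moreover have "\<forall>\<^sub>F p in ?F. f (snd p) + s p ^ d * (\<gamma> (x p) - f (x p)) = s p ^ d * \<gamma> (x p)"
    using pos by eventually_elim (simp add: z' hom algebra_simps)
  ultimately have A: "((\<lambda>p. s p ^ d * \<gamma> (x p)) \<longlongrightarrow> f z) ?F"
    using Lim_transform_eventually by force

  have "((\<lambda>p. s p ^ (d - 1) * norm (gradient \<gamma> (x p) - gradient f (x p))) \<longlongrightarrow> 0) ?F"
    unfolding s_def x_def by (rule tendsto_rescaled_smallo[OF gradient_expansion \<open>z \<noteq> 0\<close>])
  then have "((\<lambda>p. s p ^ (d - 1) *\<^sub>R (gradient \<gamma> (x p) - gradient f (x p))) \<longlongrightarrow> 0) ?F"
    by (rule tendsto_norm_zero_cancel[OF Lim_transform_eventually]) (simp add: s_def)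
  from tendsto_add[OF grad_lim this]
  have "((\<lambda>p. gradient f (snd p) + s p ^ (d - 1) *\<^sub>R (gradient \<gamma> (x p) - gradient f (x p)))
      \<longlongrightarrow> gradient f z) ?F" by simp
  moreover have "\<forall>\<^sub>F p in ?F.
      gradient f (snd p) + s p ^ (d - 1) *\<^sub>R (gradient \<gamma> (x p) - gradient f (x p))
      = s p ^ (d - 1) *\<^sub>R gradient \<gamma> (x p)"
    using pos by eventually_elim (simp add: z' grad_hom algebra_simps)
  ultimately have B: "((\<lambda>p. s p ^ (d - 1) *\<^sub>R gradient \<gamma> (x p)) \<longlongrightarrow> gradient f z) ?F"
    by (rule Lim_transform_eventually)

  have "(x \<longlongrightarrow> 0) ?F"
    using filterlim_rescaled_at_0[OF \<open>z \<noteq> 0\<close>] by (simp add: x_def filterlim_at)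
  then have "((\<lambda>p. S (x p)) \<longlongrightarrow> S 0) ?F"
    using S_cont by (rule isCont_tendsto_compose[rotated])
  then have Q: "((\<lambda>p. quad_form (S (x p)) (s p ^ (d - 1) *\<^sub>R gradient \<gamma> (x p)))
      \<longlongrightarrow> quad_form (S 0) (gradient f z)) ?F"
    using B by (rule tendsto_quad_form)
  from tendsto_imp_eventually_ne[OF Q z]
  show "\<forall>\<^sub>F p in ?F. quad_form (S (x p)) (gradient \<gamma> (x p)) \<noteq> 0"
    by eventually_elim (simp add: quad_form_scaleR)
  have "((\<lambda>p. (s p ^ d * \<gamma> (x p))\<^sup>2 / quad_form (S (x p)) (s p ^ (d - 1) *\<^sub>R gradient \<gamma> (x p)))
      \<longlongrightarrow> wald_limit f (S 0) z) ?F"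
    unfolding wald_limit_def by (intro tendsto_divide tendsto_power A Q z)
  moreover have "\<forall>\<^sub>F p in ?F.
      (s p ^ d * \<gamma> (x p))\<^sup>2 / quad_form (S (x p)) (s p ^ (d - 1) *\<^sub>R gradient \<gamma> (x p))
      = wald_statistic \<gamma> S (fst p) (x p)"
    using eventually_fst_pos
    by eventually_elim (use d in \<open>simp add: s_def wald_statistic_rescaled[of _ d]\<close>)
  ultimately show "((\<lambda>p. wald_statistic \<gamma> S (fst p) (x p)) \<longlongrightarrow> wald_limit f (S 0) z) ?F"
    by (rule Lim_transform_eventually)
qed

section \<open>Convergence of the Wald statistic\<close>

theorem proposition2p1:
  fixes \<gamma> :: "real ^ 'n::finite \<Rightarrow> real"
    and p :: "'n real_mpoly" and f :: "real ^ 'n \<Rightarrow> real" and d :: nat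
    and S :: "real ^ 'n \<Rightarrow> real ^ 'n ^ 'n"
    and M :: "nat \<Rightarrow> 'a measure" and \<theta> :: "nat \<Rightarrow> 'a \<Rightarrow> real ^ 'n"
    and T :: "nat \<Rightarrow> 'a \<Rightarrow> real"
    and P :: "'b measure" and X :: "'b \<Rightarrow> real ^ 'n"
  assumes \<gamma>_diff: "\<And>x. \<gamma> differentiable (at x)"
    and \<gamma>_C1: "continuous_on UNIV (gradient \<gamma>)"
    and \<gamma>_0: "\<gamma> 0 = 0"
    and d: "d \<ge> 2"
    and p: "mpoly_homogeneous d p"
    and f: "f = mpoly_eval p"
    and \<gamma>_expansion: "(\<lambda>x. \<gamma> x - f x) \<in> o[at 0](\<lambda>x. norm x ^ d)"
    and gradient_expansion:
      "(\<lambda>x. norm (gradient \<gamma> x - gradient f x)) \<in> o[at 0](\<lambda>x. norm x ^ (d - 1))"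
    and S_cont: "continuous_on UNIV S"
    and S_psd: "\<And>x. pos_semidefinite (S x)"
    and S_diag: "\<And>i. 0 < S 0 $ i $ i"
    and M: "\<And>n. prob_space (M n)"
    and \<theta>: "\<And>n. \<theta> n \<in> borel_measurable (M n)"
    and X: "multivariate_normal P X 0 (S 0)"
    and W_well_defined: "AE \<omega> in P. quad_form (S 0) (gradient f (X \<omega>)) \<noteq> 0"
    and \<theta>_conv: "weak_conv_bdd_cont
      (\<lambda>n. distr (M n) borel (\<lambda>\<omega>. sqrt (real n) *\<^sub>R \<theta> n \<omega>)) (distr P borel X)"
    and T_meas: "\<And>n. T n \<in> borel_measurable (M n)"
    and T: "\<And>n \<omega>. \<omega> \<in> space (M n) \<Longrightarrow>
      quad_form (S (\<theta> n \<omega>)) (gradient \<gamma> (\<theta> n \<omega>)) \<noteq> 0 \<Longrightarrow>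
      T n \<omega> = wald_statistic \<gamma> S n (\<theta> n \<omega>)"
  shows "weak_conv_m (\<lambda>n. distr (M n) borel (T n))
    (distr P borel (\<lambda>\<omega>. wald_limit f (S 0) (X \<omega>)))"
proof -
  define G where "G = {z. quad_form (S 0) (gradient f z) \<noteq> 0}"
  have C1: "C1_fun f" unfolding f by (rule C1_fun_mpoly_eval)
  have hom: "f (c *\<^sub>R x) = c ^ d * f x" for c x
    unfolding f using p by (rule mpoly_eval_scaleR)
  have [measurable]: "X \<in> borel_measurable P" and P: "prob_space P"
    using X by (simp_all add: multivariate_normal_def)
  have f_cont: "continuous_on UNIV f" using C1 by (rule C1_fun_continuous)
  have q_cont: "continuous_on UNIV (\<lambda>z. quad_form (S 0) (gradient f z))"
    using C1_fun_gradient(2)[OF C1] unfolding continuous_on_def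
    by (auto intro: tendsto_quad_form tendsto_const)
  have "open G"
    unfolding G_def using q_cont by (intro open_Collect_neq) auto
  have h_cont: "continuous_on G (wald_limit f (S 0))"
    unfolding wald_limit_def
    by (intro continuous_on_divide continuous_on_power continuous_on_subset[OF f_cont]
        continuous_on_subset[OF q_cont]) (auto simp: G_def)
  have h_meas: "wald_limit f (S 0) \<in> borel_measurable borel"
    unfolding wald_limit_def
    by (intro borel_measurable_divide borel_measurable_power borel_measurable_continuous_onI
        f_cont q_cont)
  have "isCont S 0" using S_cont by (simp add: continuous_on_eq_continuous_at)
  show ?thesis
  proof (rule extended_continuous_mapping[OF M P _ T_meas _ h_meas \<theta>_conv \<open>open G\<close> _ h_cont])
    show "(\<lambda>\<omega>. sqrt (real n) *\<^sub>R \<theta> n \<omega>) \<in> borel_measurable (M n)" for n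
      using \<theta>[of n] by simp
    show "AE \<omega> in P. X \<omega> \<in> G"
      using W_well_defined by (simp add: G_def)
    fix z and e :: real assume "z \<in> G" "e > 0"
    then have z: "quad_form (S 0) (gradient f z) \<noteq> 0" by (simp add: G_def)
    note limits = wald_statistic_local_limit
      [OF C1 hom d \<gamma>_expansion gradient_expansion \<open>isCont S 0\<close> z]
    show "\<forall>\<^sub>F (n, z') in sequentially \<times>\<^sub>F nhds z. \<forall>\<omega>\<in>space (M n).
        sqrt (real n) *\<^sub>R \<theta> n \<omega> = z' \<longrightarrow> \<bar>T n \<omega> - wald_limit f (S 0) z\<bar> < e"
      using tendstoD[OF limits(1) \<open>e > 0\<close>] limits(2) eventually_fst_pos
    proof eventually_elim
      case (elim p)
      obtain n z' where "p = (n, z')" by fastforce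
      with elim show ?case by (auto simp: T dist_real_def)
    qed
  qed simp
qed

end
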